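(* Let $A$ be a unital complex Banach algebra, let $\lambda_1,\dots,\lambda_n\in\mathbb{C}$ be pairwise distinct, let $p(\lambda):=\prod_{i=1}^n(\lambda-\lambda_i)$, and let $E_p(A):=\{a\in A\mid p(a)=0\}$. Then $E_p(A)$ is a union of its isolated points and of complex lines.
   Context: $E_p(A)$ carries the subspace topology from the norm topology of $A$; isolated points of $E_p(A)$ are understood in this topology. For $a\in A$, $p(a):=\prod_{i=1}^n(a-\lambda_i 1)$. A complex line in $A$ is a set of the form $\{a_0+\lambda b\mid\lambda\in\mathbb{C}\}$ with $a_0,b\in A$ and $b\neq 0$. Since $E_p(A)$ is the stated union, the complex lines in question are contained in $E_p(A)$; the family of isolated points or the family of lines may be empty. *)

theory Defs
  imports "HOL-Analysis.Analysis"
begin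

(* The library only provides real Banach algebras.  As in the AFP's complex vector spaces, the
   complex scalar multiplication extends the existing real one, so that norm and topology are the
   inherited ones.  Using monoid_mult for the unit (instead of real_normed_algebra_1) imposes
   neither norm 1 = 1 nor 0 \<noteq> 1. *)
class unital_complex_banach_algebra = real_normed_algebra + banach + monoid_mult +
  fixes scaleC :: "complex \<Rightarrow> 'a \<Rightarrow> 'a"  (infixr "*\<^sub>C" 75)
  assumes scaleC_of_real: "complex_of_real r *\<^sub>C x = r *\<^sub>R x"
    and scaleC_add_right: "z *\<^sub>C (x + y) = z *\<^sub>C x + z *\<^sub>C y"
    and scaleC_add_left: "(z + w) *\<^sub>C x = z *\<^sub>C x + w *\<^sub>C x"
    and scaleC_scaleC: "z *\<^sub>C (w *\<^sub>C x) = (z * w) *\<^sub>C x"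
    and mult_scaleC_left: "(z *\<^sub>C x) * y = z *\<^sub>C (x * y)"
    and mult_scaleC_right: "x * (z *\<^sub>C y) = z *\<^sub>C (x * y)"
    and norm_scaleC: "norm (z *\<^sub>C x) = cmod z * norm x"

(* p(a) = (a - l 1 1) \<dots> (a - l n 1); a product over a list because the algebra need not be
   commutative. *)
definition poly_eval :: "nat \<Rightarrow> (nat \<Rightarrow> complex) \<Rightarrow> 'a \<Rightarrow> 'a::unital_complex_banach_algebra"
  where "poly_eval n l a = (\<Prod>i\<leftarrow>[1..<Suc n]. a - l i *\<^sub>C 1)"

definition E_set :: "nat \<Rightarrow> (nat \<Rightarrow> complex) \<Rightarrow> 'a::unital_complex_banach_algebra set"
  where "E_set n l = {a. poly_eval n l a = 0}"

definition complex_line :: "'a::unital_complex_banach_algebra set \<Rightarrow> bool"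
  where "complex_line L \<longleftrightarrow> (\<exists>a0 b. b \<noteq> 0 \<and> L = {a0 + z *\<^sub>C b | z. True})"

end

theory Submission
  imports Defs
begin

text \<open>
  An element \<open>a\<close> of \<open>E_set n l\<close> is diagonalisable: the unit splits as a sum of elements
  \<open>e i\<close> with \<open>a * e i = l i *\<^sub>C e i\<close> that commute with everything commuting with \<open>a\<close>
  (\<open>eigen_decomposition\<close>).  Sandwiching between two such splittings, an element \<open>x\<close>
  satisfies \<open>a * x = x * c\<close> as soon as its off-diagonal blocks \<open>e i * x * f j\<close> vanish
  (\<open>intertwines_if_block_diagonal\<close>).  This criterion is used twice.

  If \<open>a\<close> is not central, take \<open>x\<close> not commuting with \<open>a\<close>.  With \<open>c = a\<close>, the criterion yields
  a nonzero block \<open>b = e i * x * e j\<close> with \<open>i \<noteq> j\<close>.  It has square zero, so the elements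
  \<open>1 + w *\<^sub>C b\<close> are invertible, and conjugating \<open>a\<close> by them moves it along the complex
  line through \<open>a\<close> in direction \<open>b\<close>.  Since \<open>E_set n l\<close> is invariant under conjugation, it
  contains that line.

  If \<open>a\<close> is central, it commutes with every other \<open>c\<close> in \<open>E_set n l\<close>.  On a block
  \<open>e i * f j\<close> multiplication by \<open>c - a\<close> is multiplication by the scalar \<open>l j - l i\<close>; when
  \<open>c\<close> is closer to \<open>a\<close> than any two of the roots are to each other, this forces the blocks
  with \<open>i \<noteq> j\<close> to vanish, and the criterion with \<open>x = 1\<close> gives \<open>c = a\<close>.  So \<open>a\<close> is isolated.
\<close>

lemma vector_space_scaleC:
  "vector_space (scaleC :: complex \<Rightarrow> 'a \<Rightarrow> 'a::unital_complex_banach_algebra)"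
proof
  fix x :: 'a
  show "1 *\<^sub>C x = x"
    using scaleC_of_real[of 1 x] by simp
qed (simp_all add: scaleC_add_right scaleC_add_left scaleC_scaleC)

interpretation scaleC: vector_space
  "scaleC :: complex \<Rightarrow> 'a \<Rightarrow> 'a::unital_complex_banach_algebra"
  by (rule vector_space_scaleC)

text \<open>
  The splitting is built one root at a time, which avoids Lagrange interpolation: if the
  product without the last factor \<open>a - l k *\<^sub>C 1\<close> annihilates \<open>y' = (a - l k *\<^sub>C 1) * y\<close>, then
  dividing the \<open>i\<close>-th component of \<open>y'\<close> by \<open>l i - l k\<close> gives that of \<open>y\<close>, and what remains of \<open>y\<close>
  is killed by \<open>a - l k *\<^sub>C 1\<close>.  The components inherit from \<open>y\<close> membership in the bicommutant
  of \<open>a\<close>.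
\<close>

lemma eigen_decomposition:
  fixes a y :: "'a::unital_complex_banach_algebra"
  assumes "distinct xs" and "inj_on l (set xs)"
    and "(\<Prod>i\<leftarrow>xs. a - l i *\<^sub>C 1) * y = 0"
    and "\<And>z. a * z = z * a \<Longrightarrow> y * z = z * y"
  shows "\<exists>e. y = (\<Sum>i\<in>set xs. e i) \<and>
    (\<forall>i\<in>set xs. a * e i = l i *\<^sub>C e i \<and> (\<forall>z. a * z = z * a \<longrightarrow> e i * z = z * e i))"
  using assms
proof (induction xs arbitrary: y rule: rev_induct)
  case Nil
  then show ?case by simp
next
  case (snoc k xs)
  define y' where "y' = (a - l k *\<^sub>C 1) * y"
  have y'_eq: "y' = a * y - l k *\<^sub>C y"
    by (simp add: y'_def left_diff_distrib mult_scaleC_left)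
  have k: "k \<notin> set xs"
    using snoc.prems(1) by simp
  have neq: "l i \<noteq> l k" if "i \<in> set xs" for i
    using snoc.prems(2) that k by (auto simp: inj_on_def)
  have "y' * z = z * y'" if "a * z = z * a" for z
  proof -
    have "a * y * z = z * (a * y)"
      using that snoc.prems(4)[OF that] by (metis mult.assoc)
    then show ?thesis
      using snoc.prems(4)[OF that]
      by (simp add: y'_eq left_diff_distrib right_diff_distrib mult_scaleC_left mult_scaleC_right)
  qed
  moreover have "(\<Prod>i\<leftarrow>xs. a - l i *\<^sub>C 1) * y' = 0"
    using snoc.prems(3) by (simp add: y'_def mult.assoc)
  moreover have "distinct xs" "inj_on l (set xs)"
    using snoc.prems(1,2) by (auto simp: inj_on_def)
  ultimately obtain e' where y'_sum: "y' = (\<Sum>i\<in>set xs. e' i)"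
    and eig: "\<And>i. i \<in> set xs \<Longrightarrow> a * e' i = l i *\<^sub>C e' i"
    and comm: "\<And>i z. i \<in> set xs \<Longrightarrow> a * z = z * a \<Longrightarrow> e' i * z = z * e' i"
    using snoc.IH[of y'] by blast
  define g where "g i = inverse (l i - l k) *\<^sub>C e' i" for i
  have g_eig: "a * g i = l i *\<^sub>C g i" if "i \<in> set xs" for i
    using eig[OF that] by (simp add: g_def mult_scaleC_right scaleC_scaleC mult.commute)
  have g_comm: "g i * z = z * g i" if "i \<in> set xs" "a * z = z * a" for i z
    using comm[OF that] by (simp add: g_def mult_scaleC_left mult_scaleC_right)
  have g_diff: "a * g i - l k *\<^sub>C g i = e' i" if "i \<in> set xs" for i
    using neq[OF that] unfolding g_eig[OF that]
    by (simp add: g_def scaleC_scaleC flip: scaleC.scale_left_diff_distrib left_diff_distrib)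
  define r where "r = y - (\<Sum>i\<in>set xs. g i)"
  have "a * (\<Sum>i\<in>set xs. g i) - l k *\<^sub>C (\<Sum>i\<in>set xs. g i) = y'"
    by (simp add: y'_sum g_diff sum_distrib_left scaleC.scale_sum_right flip: sum_subtractf)
  then have r_eig: "a * r = l k *\<^sub>C r"
    by (simp add: r_def y'_eq algebra_simps)
  have r_comm: "r * z = z * r" if "a * z = z * a" for z
    using snoc.prems(4)[OF that] g_comm[OF _ that]
    by (simp add: r_def left_diff_distrib right_diff_distrib sum_distrib_left sum_distrib_right)
  define e where "e i = (if i = k then r else g i)" for i
  have "(\<Sum>i\<in>set xs. e i) = (\<Sum>i\<in>set xs. g i)"
    using k by (intro sum.cong) (auto simp: e_def)
  then have "y = (\<Sum>i\<in>set (xs @ [k]). e i)"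
    using k by (simp add: e_def r_def)
  moreover have "\<forall>i\<in>set (xs @ [k]). a * e i = l i *\<^sub>C e i
      \<and> (\<forall>z. a * z = z * a \<longrightarrow> e i * z = z * e i)"
    using g_eig g_comm r_eig r_comm by (auto simp: e_def)
  ultimately show ?case by blast
qed

lemma E_set_splitting:
  fixes a :: "'a::unital_complex_banach_algebra"
  assumes "inj_on l {1..n}" and "a \<in> E_set n l"
  obtains e where "(\<Sum>i\<in>{1..n}. e i) = 1"
    and "\<And>i. i \<in> {1..n} \<Longrightarrow> a * e i = l i *\<^sub>C e i"
    and "\<And>i z. i \<in> {1..n} \<Longrightarrow> a * z = z * a \<Longrightarrow> e i * z = z * e i"
proof -
  have set: "set [1..<Suc n] = {1..n}" by auto
  have "\<exists>e. (1::'a) = (\<Sum>i\<in>set [1..<Suc n]. e i) \<and>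
    (\<forall>i\<in>set [1..<Suc n]. a * e i = l i *\<^sub>C e i \<and> (\<forall>z. a * z = z * a \<longrightarrow> e i * z = z * e i))"
    by (rule eigen_decomposition)
      (use assms in \<open>simp_all only: set E_set_def poly_eval_def distinct_upt mem_Collect_eq
        mult_1_left mult_1_right\<close>)
  then show ?thesis unfolding set using that by metis
qed

lemma intertwines_if_block_diagonal:
  fixes a c x :: "'a::unital_complex_banach_algebra"
  assumes "finite I"
    and e: "(\<Sum>i\<in>I. e i) = 1" "\<And>i. i \<in> I \<Longrightarrow> a * e i = l i *\<^sub>C e i"
    and f: "(\<Sum>i\<in>I. f i) = 1" "\<And>i. i \<in> I \<Longrightarrow> f i * c = l i *\<^sub>C f i"
    and off: "\<And>i j. i \<in> I \<Longrightarrow> j \<in> I \<Longrightarrow> i \<noteq> j \<Longrightarrow> e i * x * f j = 0"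
  shows "a * x = x * c"
proof -
  have "x = (\<Sum>i\<in>I. e i) * x * (\<Sum>j\<in>I. f j)"
    by (simp add: e(1) f(1))
  also have "\<dots> = (\<Sum>i\<in>I. \<Sum>j\<in>I. e i * x * f j)"
    by (subst sum_distrib_right) (rule sum_product)
  also have "\<dots> = (\<Sum>i\<in>I. \<Sum>j\<in>I. if j = i then e i * x * f i else 0)"
    using off by (intro sum.cong) auto
  also have "\<dots> = (\<Sum>i\<in>I. e i * x * f i)"
    using \<open>finite I\<close> by simp
  finally have x: "x = (\<Sum>i\<in>I. e i * x * f i)" .
  have "a * (e i * x * f i) = e i * x * f i * c" if "i \<in> I" for i
  proof -
    have "a * (e i * x * f i) = (a * e i) * x * f i"
      by (simp add: mult.assoc)
    also have "\<dots> = e i * x * (f i * c)"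
      using e(2)[OF that] f(2)[OF that] by (simp add: mult_scaleC_left mult_scaleC_right)
    finally show ?thesis by (simp add: mult.assoc)
  qed
  then have "a * (\<Sum>i\<in>I. e i * x * f i) = (\<Sum>i\<in>I. e i * x * f i) * c"
    by (simp add: sum_distrib_left sum_distrib_right)
  then show ?thesis by (simp flip: x)
qed

lemma poly_eval_conjugate:
  fixes a u v :: "'a::unital_complex_banach_algebra"
  assumes "u * v = 1" and "v * u = 1"
  shows "poly_eval n l (u * a * v) = u * poly_eval n l a * v"
proof -
  have "(\<Prod>i\<leftarrow>xs. u * a * v - l i *\<^sub>C 1) = u * (\<Prod>i\<leftarrow>xs. a - l i *\<^sub>C 1) * v" for xs
  proof (induction xs)
    case Nil
    then show ?case using assms by simp
  next
    case (Cons k xs)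
    have "u * a * v - l k *\<^sub>C 1 = u * (a - l k *\<^sub>C 1) * v"
      using assms
      by (simp add: left_diff_distrib right_diff_distrib mult_scaleC_left mult_scaleC_right)
    moreover have "u * s * v * (u * t * v) = u * (s * t) * v" for s t
      using assms by (metis mult.assoc mult_1_left)
    ultimately show ?case using Cons by simp
  qed
  then show ?thesis by (simp add: poly_eval_def)
qed

text \<open>
  Conjugation by \<open>1 + w *\<^sub>C b\<close>, whose inverse is \<open>1 - w *\<^sub>C b\<close>, adds
  \<open>(w * (\<nu> - \<mu>)) *\<^sub>C b\<close> to \<open>a\<close>, and every multiple of \<open>b\<close> arises in this way.
\<close>

lemma line_in_E_set:
  fixes a b :: "'a::unital_complex_banach_algebra"
  assumes a: "a \<in> E_set n l" and ab: "a * b = \<mu> *\<^sub>C b" and ba: "b * a = \<nu> *\<^sub>C b"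
    and "\<mu> \<noteq> \<nu>"
  shows "a + z *\<^sub>C b \<in> E_set n l"
proof -
  \<comment> \<open>Computing \<open>b * a * b\<close> in two ways gives \<open>\<nu> *\<^sub>C b\<^sup>2 = \<mu> *\<^sub>C b\<^sup>2\<close>.\<close>
  have "\<nu> *\<^sub>C (b * b) = \<mu> *\<^sub>C (b * b)"
    using ab ba by (metis mult.assoc mult_scaleC_left mult_scaleC_right)
  then have bb: "b * b = 0"
    using \<open>\<mu> \<noteq> \<nu>\<close> by simp
  define w where "w = z / (\<nu> - \<mu>)"
  define u where "u = 1 + w *\<^sub>C b"
  define v where "v = 1 - w *\<^sub>C b"
  have uv: "u * v = 1" "v * u = 1"
    by (simp_all add: u_def v_def algebra_simps mult_scaleC_left mult_scaleC_right bb)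
  have "u * a * v = a + (w * \<nu>) *\<^sub>C b - (w * \<mu>) *\<^sub>C b"
    by (simp add: u_def v_def algebra_simps mult_scaleC_left mult_scaleC_right ab ba bb)
  also have "\<dots> = a + (w * (\<nu> - \<mu>)) *\<^sub>C b"
    by (simp add: right_diff_distrib scaleC.scale_left_diff_distrib)
  also have "\<dots> = a + z *\<^sub>C b"
    using \<open>\<mu> \<noteq> \<nu>\<close> by (simp add: w_def)
  finally have "poly_eval n l (a + z *\<^sub>C b) = u * poly_eval n l a * v"
    using poly_eval_conjugate[OF uv] by metis
  then show ?thesis
    using a by (simp add: E_set_def)
qed

lemma noncentral_on_line:
  fixes a x :: "'a::unital_complex_banach_algebra"
  assumes inj: "inj_on l {1..n}" and a: "a \<in> E_set n l" and "a * x \<noteq> x * a"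
  shows "\<exists>L. complex_line L \<and> a \<in> L \<and> L \<subseteq> E_set n l"
proof -
  obtain e where sum: "(\<Sum>i\<in>{1..n}. e i) = 1"
    and eig: "\<And>i. i \<in> {1..n} \<Longrightarrow> a * e i = l i *\<^sub>C e i"
    and comm: "\<And>i z. i \<in> {1..n} \<Longrightarrow> a * z = z * a \<Longrightarrow> e i * z = z * e i"
    using E_set_splitting[OF inj a] by blast
  have eig': "e i * a = l i *\<^sub>C e i" if "i \<in> {1..n}" for i
    using eig comm that by simp
  have "\<exists>i\<in>{1..n}. \<exists>j\<in>{1..n}. i \<noteq> j \<and> e i * x * e j \<noteq> 0"
  proof (rule ccontr)
    assume "\<not> ?thesis"
    then have "e i * x * e j = 0" if "i \<in> {1..n}" "j \<in> {1..n}" "i \<noteq> j" for i j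
      using that by blast
    then have "a * x = x * a"
      by (intro intertwines_if_block_diagonal[OF _ sum eig sum eig']) simp_all
    with \<open>a * x \<noteq> x * a\<close> show False by contradiction
  qed
  then obtain i j where ij: "i \<in> {1..n}" "j \<in> {1..n}" "i \<noteq> j" and nz: "e i * x * e j \<noteq> 0"
    by blast
  define b where "b = e i * x * e j"
  have "a * b = l i *\<^sub>C b"
    using eig[OF ij(1)] by (simp add: b_def mult_scaleC_left flip: mult.assoc)
  moreover have "b * a = l j *\<^sub>C b"
    using eig'[OF ij(2)] by (simp add: b_def mult_scaleC_right mult.assoc)
  moreover have "l i \<noteq> l j"
    using inj_onD[OF inj _ ij(1,2)] ij(3) by blast
  ultimately have "a + z *\<^sub>C b \<in> E_set n l" for z
    using line_in_E_set[OF a] by blast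
  then have "{a + z *\<^sub>C b | z. True} \<subseteq> E_set n l"
    by auto
  moreover have "complex_line {a + z *\<^sub>C b | z. True}"
    using nz by (auto simp: complex_line_def b_def)
  moreover have "a \<in> {a + z *\<^sub>C b | z. True}"
    by (auto intro: exI[of _ 0])
  ultimately show ?thesis by blast
qed

lemma commuting_close_imp_eq:
  fixes a c :: "'a::unital_complex_banach_algebra"
  assumes inj: "inj_on l {1..n}" and a: "a \<in> E_set n l" and c: "c \<in> E_set n l"
    and ac: "a * c = c * a"
    and close: "\<And>i j. i \<in> {1..n} \<Longrightarrow> j \<in> {1..n} \<Longrightarrow> i \<noteq> j \<Longrightarrow> dist c a < dist (l i) (l j)"
  shows "a = c"
proof -
  obtain e where sum_e: "(\<Sum>i\<in>{1..n}. e i) = 1"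
    and eig_e: "\<And>i. i \<in> {1..n} \<Longrightarrow> a * e i = l i *\<^sub>C e i"
    and comm_e: "\<And>i z. i \<in> {1..n} \<Longrightarrow> a * z = z * a \<Longrightarrow> e i * z = z * e i"
    using E_set_splitting[OF inj a] by blast
  obtain f where sum_f: "(\<Sum>i\<in>{1..n}. f i) = 1"
    and eig_f: "\<And>i. i \<in> {1..n} \<Longrightarrow> c * f i = l i *\<^sub>C f i"
    and comm_f: "\<And>i z. i \<in> {1..n} \<Longrightarrow> c * z = z * c \<Longrightarrow> f i * z = z * f i"
    using E_set_splitting[OF inj c] by blast
  have eig_f': "f i * c = l i *\<^sub>C f i" if "i \<in> {1..n}" for i
    using eig_f comm_f that by simp
  have "e i * 1 * f j = 0" if ij: "i \<in> {1..n}" "j \<in> {1..n}" "i \<noteq> j" for i j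
  proof (rule ccontr)
    assume nz: "e i * 1 * f j \<noteq> 0"
    have "(c - a) * (e i * f j) = e i * (c * f j) - (a * e i) * f j"
      using comm_e[OF ij(1) ac] by (simp add: left_diff_distrib flip: mult.assoc)
    also have "\<dots> = (l j - l i) *\<^sub>C (e i * f j)"
      using eig_e[OF ij(1)] eig_f[OF ij(2)]
      by (simp add: mult_scaleC_left mult_scaleC_right scaleC.scale_left_diff_distrib)
    finally have "cmod (l j - l i) * norm (e i * f j) \<le> norm (c - a) * norm (e i * f j)"
      using norm_mult_ineq[of "c - a" "e i * f j"] by (simp add: norm_scaleC)
    then have "dist (l i) (l j) \<le> dist c a"
      using nz by (simp add: dist_norm norm_minus_commute)
    with close[OF ij] show False by simp
  qed
  then have "a * 1 = 1 * c"
    by (intro intertwines_if_block_diagonal[OF _ sum_e eig_e sum_f eig_f']) auto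
  then show ?thesis by simp
qed

lemma central_isolated:
  fixes a :: "'a::unital_complex_banach_algebra"
  assumes inj: "inj_on l {1..n}" and a: "a \<in> E_set n l" and central: "\<And>x. a * x = x * a"
  shows "a isolated_in E_set n l"
proof -
  define D where "D = (\<lambda>(i, j). dist (l i) (l j)) ` {(i, j). i \<in> {1..n} \<and> j \<in> {1..n} \<and> i \<noteq> j}"
  \<comment> \<open>The element 1 only serves to make the set nonempty when there are fewer than two roots.\<close>
  define \<delta> where "\<delta> = Min (insert 1 D)"
  have "finite {(i, j). i \<in> {1..n} \<and> j \<in> {1..n} \<and> i \<noteq> j}"
    by (rule finite_subset[of _ "{1..n} \<times> {1..n}"]) auto
  then have "finite D"
    by (simp add: D_def)
  moreover have "d > 0" if "d \<in> D" for d
    using that inj_onD[OF inj] by (fastforce simp: D_def)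
  ultimately have "\<delta> > 0"
    by (simp add: \<delta>_def)
  have \<delta>_le: "\<delta> \<le> dist (l i) (l j)" if "i \<in> {1..n}" "j \<in> {1..n}" "i \<noteq> j" for i j
  proof -
    have "dist (l i) (l j) \<in> D"
      using that by (force simp: D_def)
    then show ?thesis
      using \<open>finite D\<close> by (simp add: \<delta>_def)
  qed
  have "c = a" if "c \<in> E_set n l" "dist c a < \<delta>" for c
    using commuting_close_imp_eq[OF inj a that(1) central] that(2) \<delta>_le by fastforce
  then have "ball a \<delta> \<inter> E_set n l = {a}"
    using a \<open>\<delta> > 0\<close> by (auto simp: dist_commute)
  then show ?thesis
    using a by (auto simp: isolated_in_def intro!: exI[of _ "ball a \<delta>"])
qed

theorem corollary8:
  fixes n :: nat and l :: "nat \<Rightarrow> complex"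
  assumes "inj_on l {1..n}"
  shows "\<exists>Ls :: 'a::unital_complex_banach_algebra set set.
           (\<forall>L\<in>Ls. complex_line L) \<and>
           E_set n l = {a. a isolated_in E_set n l} \<union> \<Union>Ls"
proof (intro exI conjI)
  let ?Ls = "{L :: 'a set. complex_line L \<and> L \<subseteq> E_set n l}"
  show "\<forall>L\<in>?Ls. complex_line L" by simp
  show "E_set n l = {a. a isolated_in E_set n l} \<union> \<Union>?Ls"
  proof
    show "E_set n l \<subseteq> {a. a isolated_in E_set n l} \<union> \<Union>?Ls"
      using central_isolated[OF assms] noncentral_on_line[OF assms] by blast
    show "{a. a isolated_in E_set n l} \<union> \<Union>?Ls \<subseteq> E_set n l"
      by (auto simp: isolated_in_def)
  qed
qed

end
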